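(* Let $K\in\mathbb{N}$ and let $G=(Q,\Sigma,\delta,I)$ be a discrete-event system with secret states $Q_S\subseteq Q$, non-secret states $Q_{NS}\subseteq Q$, and projection $P\colon\Sigma^*\to\Sigma_o^*$. Let $G'$, with secret states $Q_S'$, non-secret states $Q_{NS}'$, be the system constructed in the context from $G$ and the $K$-step counter automaton $\mathcal{A}_K$ over an alphabet $\Gamma$, let $\Sigma'=\Sigma\cup(\Sigma_o\times\Gamma)$, and let $P'\colon(\Sigma'\cup\{@\})^*\to(\Sigma_o\cup\{@\}\cup(\Sigma_o\times\Gamma))^*$ be the projection. Then $G$ is $K$-step opaque with respect to $Q_S$, $Q_{NS}$, and $P$ if and only if $G'$ is current-state opaque with respect to $Q_S'$, $Q_{NS}'$, and $P'$.
   Context: An NFA over a finite nonempty alphabet $\Sigma$ is $(Q,\Sigma,\delta,I,F)$ with finite state set $Q$, initial states $I\subseteq Q$, marked states $F\subseteq Q$ (omitted if irrelevant), and $\delta\colon Q\times\Sigma\to 2^Q$, extended in the usual way to $2^Q\times\Sigma^*$; a transition $(p,a,q)$ means $q\in\delta(p,a)$. $L(G)=\{w\mid\delta(I,w)\ne\emptyset\}$ is the generated language and $L_m(G)=\{w\mid\delta(I,w)\cap F\neq\emptyset\}$ the marked (accepted) language. A discrete-event system (DES) is an NFA together with a partition of $\Sigma$ into observable events $\Sigma_o$ and unobservable events $\Sigma_{uo}$. A projection is the morphism on strings erasing the unobservable events and keeping the observable ones. $K$-step opacity: $G$ is $K$-step opaque w.r.t. secret states $Q_S$, non-secret states $Q_{NS}$,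 and $P$ if for every $st\in L(G)$ with $|P(t)|\le K$ and $\delta(\delta(I,s)\cap Q_S,t)\neq\emptyset$, there is $s't'\in L(G)$ such that $P(s)=P(s')$, $P(t)=P(t')$, and $\delta(\delta(I,s')\cap Q_{NS},t')\neq\emptyset$. Current-state opacity is $0$-step opacity. States of $G$ in neither $Q_S$ nor $Q_{NS}$ are allowed. Counter: $\mathcal{A}_K$ is an NFA over an alphabet $\Gamma$ disjoint from $\Sigma$ with a unique initial state $q_0$, whose observer (subset-construction determinization) has a unique path of length $K$ from the initial state consisting solely of non-marked states while all other states are marked; that is, there is a string $W\in\Gamma^*$ with $|W|=K$ such that the strings of $\Gamma^*$ not accepted by $\mathcal{A}_K$ are exactly the prefixes of $W$. Construction of $G'$: let $G^+$ and $G^-$ be two disjoint copies of $G$ with state sets $Q^+=\{q^+\mid q\in Q\}$ and $Q^-=\{q^-\mid q\in Q\}$. In $G^+$ and $G^-$, replace every observable transition $(p,\sigma,q)$, $\sigma\in\Sigma_o$, by the transitions $(p,(\sigma,\gamma),q)$ for all $\gamma\in\Gamma$ (unobservable transitions are kept), obtaining $\tilde G^+$ and $\tilde G^-$. In $\mathcal{A}_K$, replace every transition $(p,\gamma,q)$ by the transitions $(p,(\sigma,\gamma),q)$ for all $\sigma\in\Sigma_o$, obtaining $\tilde{\mathcal{A}}_K$. Make all states of $\tilde G^+$ initial and marked, and let $\tilde G^+\|\tilde{\mathcal{A}}_K$ be the synchronous product, in which the two components synchronize on the events of $\Sigma_o\times\Gamma$ and the unobservable events of $\Sigma_{uo}$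 are executed by $\tilde G^+$ alone; a state of the product is marked iff both of its components are marked. $G'$ is the disjoint union of $G$, $\tilde G^-$, and $\tilde G^+\|\tilde{\mathcal{A}}_K$, with initial states $I$ (those of $G$), together with the transitions $(q,@,(q^+,q_0))$ for every $q\in Q_S$ and $(q,@,q^-)$ for every $q\in Q_{NS}$, where $@\notin\Sigma'$ is a new observable event. The observable events of $G'$ are $\Sigma_o\cup\{@\}\cup(\Sigma_o\times\Gamma)$. The set $Q_S'$ consists of the non-marked states of $\tilde G^+\|\tilde{\mathcal{A}}_K$, and $Q_{NS}'$ consists of all other states of $G'$. *)

theory Defs
  imports Main "HOL-Library.Sublist"
begin

record ('q, 'e) nfa =
  states :: "'q set"
  alphabet :: "'e set"
  transitions :: "('q \<times> 'e \<times> 'q) set"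
  initial :: "'q set"
  marked :: "'q set"

definition is_nfa :: "('q, 'e, 'z) nfa_scheme \<Rightarrow> bool" where
  "is_nfa A \<longleftrightarrow> finite (states A) \<and> finite (alphabet A) \<and> alphabet A \<noteq> {} \<and>
     transitions A \<subseteq> states A \<times> alphabet A \<times> states A \<and>
     initial A \<subseteq> states A \<and> marked A \<subseteq> states A"

definition delta :: "('q, 'e, 'z) nfa_scheme \<Rightarrow> 'q \<Rightarrow> 'e \<Rightarrow> 'q set" where
  "delta A p a = {q. (p, a, q) \<in> transitions A}"

fun delta_star :: "('q, 'e, 'z) nfa_scheme \<Rightarrow> 'q set \<Rightarrow> 'e list \<Rightarrow> 'q set" where
  "delta_star A X [] = X"
| "delta_star A X (a # w) = delta_star A (\<Union>p\<in>X. delta A p a) w"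

definition generated_language :: "('q, 'e, 'z) nfa_scheme \<Rightarrow> 'e list set" where
  "generated_language A = {w \<in> lists (alphabet A). delta_star A (initial A) w \<noteq> {}}"

definition marked_language :: "('q, 'e, 'z) nfa_scheme \<Rightarrow> 'e list set" where
  "marked_language A = {w \<in> lists (alphabet A). delta_star A (initial A) w \<inter> marked A \<noteq> {}}"

text \<open>The unobservable events are those in \<open>alphabet G - observable G\<close>.\<close>

record ('q, 'e) des = "('q, 'e) nfa" +
  observable :: "'e set"

definition is_des :: "('q, 'e) des \<Rightarrow> bool" where
  "is_des G \<longleftrightarrow> is_nfa G \<and> observable G \<subseteq> alphabet G"

definition projection :: "'e set \<Rightarrow> 'e list \<Rightarrow> 'e list" where
  "projection Obs w = filter (\<lambda>a. a \<in> Obs) w"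

definition k_step_opaque ::
  "nat \<Rightarrow> ('q, 'e) des \<Rightarrow> 'q set \<Rightarrow> 'q set \<Rightarrow> ('e list \<Rightarrow> 'e list) \<Rightarrow> bool" where
  "k_step_opaque K G QS QNS P \<longleftrightarrow>
     (\<forall>s t. s @ t \<in> generated_language G \<and> length (P t) \<le> K \<and>
            delta_star G (delta_star G (initial G) s \<inter> QS) t \<noteq> {} \<longrightarrow>
        (\<exists>s' t'. s' @ t' \<in> generated_language G \<and> P s = P s' \<and> P t = P t' \<and>
            delta_star G (delta_star G (initial G) s' \<inter> QNS) t' \<noteq> {}))"

definition current_state_opaque ::
  "('q, 'e) des \<Rightarrow> 'q set \<Rightarrow> 'q set \<Rightarrow> ('e list \<Rightarrow> 'e list) \<Rightarrow> bool" where
  "current_state_opaque G QS QNS P \<longleftrightarrow> k_step_opaque 0 G QS QNS P"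

text \<open>The strings leading the observer of a \<open>K\<close>-step counter to a non-marked state are
  those that spell an initial part of its only path through non-marked states.  Since
  \<open>alphabet A\<close> is nonempty, these strings are not blocked in \<open>A\<close>.\<close>

definition step_counter :: "nat \<Rightarrow> ('c, 'g) nfa \<Rightarrow> 'c \<Rightarrow> bool" where
  "step_counter K A q0 \<longleftrightarrow> is_nfa A \<and> initial A = {q0} \<and>
     (\<exists>W \<in> lists (alphabet A). length W = K \<and>
        lists (alphabet A) - marked_language A = {w. prefix w W})"

definition sync_product ::
  "('p, 'e) nfa \<Rightarrow> ('q, 'e) nfa \<Rightarrow> ('p \<times> 'q, 'e) nfa" where
  "sync_product A B =
     \<lparr> states = states A \<times> states B,
       alphabet = alphabet A \<union> alphabet B,
       transitions =
         {((p, q), e, (p', q')) | p q e p' q'. e \<in> alphabet A \<inter> alphabet B \<and>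
            (p, e, p') \<in> transitions A \<and> (q, e, q') \<in> transitions B} \<union>
         {((p, q), e, (p', q)) | p q e p'. e \<in> alphabet A - alphabet B \<and>
            (p, e, p') \<in> transitions A \<and> q \<in> states B} \<union>
         {((p, q), e, (p, q')) | p q e q'. e \<in> alphabet B - alphabet A \<and>
            p \<in> states A \<and> (q, e, q') \<in> transitions B},
       initial = initial A \<times> initial B,
       marked = marked A \<times> marked B \<rparr>"

text \<open>Events of the constructed system: the events of \<open>G\<close>, the pairs
  \<open>(\<sigma>, \<gamma>)\<close>, and the fresh event \<open>@\<close>.\<close>

datatype ('e, 'g) event = Old 'e | Paired 'e 'g | At

text \<open>States of the constructed system: \<open>Orig q\<close> is the state \<open>q\<close> of \<open>G\<close>,
  \<open>Minus q\<close> is \<open>q\<^sup>-\<close>, and \<open>Plus (q, c)\<close> is the product state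
  \<open>(q\<^sup>+, c)\<close>.  As these constructors keep the two copies of \<open>G\<close> apart, the automata
  below use the plain states of \<open>G\<close> for both copies.\<close>

datatype ('q, 'c) state = Orig 'q | Minus 'q | Plus "'q \<times> 'c"

definition paired_events :: "'e set \<Rightarrow> 'g set \<Rightarrow> ('e, 'g) event set" where
  "paired_events So Ga = {Paired a g | a g. a \<in> So \<and> g \<in> Ga}"

definition tilde_minus :: "('q, 'e) des \<Rightarrow> 'g set \<Rightarrow> ('q, ('e, 'g) event) nfa" where
  "tilde_minus G Ga =
     \<lparr> states = states G,
       alphabet = Old ` (alphabet G - observable G) \<union> paired_events (observable G) Ga,
       transitions =
         {(p, Old a, q) | p a q. (p, a, q) \<in> transitions G \<and> a \<notin> observable G} \<union>
         {(p, Paired a g, q) | p a g q. (p, a, q) \<in> transitions G \<and> a \<in> observable G \<and> g \<in> Ga},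
       initial = initial G,
       marked = marked G \<rparr>"

definition tilde_plus :: "('q, 'e) des \<Rightarrow> 'g set \<Rightarrow> ('q, ('e, 'g) event) nfa" where
  "tilde_plus G Ga = (tilde_minus G Ga) \<lparr> initial := states G, marked := states G \<rparr>"

definition tilde_counter :: "'e set \<Rightarrow> ('c, 'g) nfa \<Rightarrow> ('c, ('e, 'g) event) nfa" where
  "tilde_counter So A =
     \<lparr> states = states A,
       alphabet = paired_events So (alphabet A),
       transitions = {(p, Paired a g, q) | p a g q. (p, g, q) \<in> transitions A \<and> a \<in> So},
       initial = initial A,
       marked = marked A \<rparr>"

definition counter_product ::
  "('q, 'e) des \<Rightarrow> ('c, 'g) nfa \<Rightarrow> ('q \<times> 'c, ('e, 'g) event) nfa" where
  "counter_product G A =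
     sync_product (tilde_plus G (alphabet A)) (tilde_counter (observable G) A)"

definition opacity_reduction ::
  "('q, 'e) des \<Rightarrow> 'q set \<Rightarrow> 'q set \<Rightarrow> ('c, 'g) nfa \<Rightarrow> 'c \<Rightarrow> (('q, 'c) state, ('e, 'g) event) des" where
  "opacity_reduction G QS QNS A q0 =
     (let GM = tilde_minus G (alphabet A); GP = counter_product G A in
     \<lparr> states = Orig ` states G \<union> Minus ` states GM \<union> Plus ` states GP,
       alphabet = Old ` alphabet G \<union> paired_events (observable G) (alphabet A) \<union> {At},
       transitions =
         {(Orig p, Old a, Orig q) | p a q. (p, a, q) \<in> transitions G} \<union>
         {(Minus p, e, Minus q) | p e q. (p, e, q) \<in> transitions GM} \<union>
         {(Plus x, e, Plus y) | x e y. (x, e, y) \<in> transitions GP} \<union>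
         {(Orig q, At, Plus (q, q0)) | q. q \<in> QS} \<union>
         {(Orig q, At, Minus q) | q. q \<in> QNS},
       initial = Orig ` initial G,
       marked = Orig ` marked G \<union> Minus ` marked GM \<union> Plus ` marked GP,
       observable = Old ` observable G \<union> {At} \<union> paired_events (observable G) (alphabet A) \<rparr>)"

definition reduction_secret ::
  "('q, 'e) des \<Rightarrow> ('c, 'g) nfa \<Rightarrow> ('q, 'c) state set" where
  "reduction_secret G A = Plus ` (states (counter_product G A) - marked (counter_product G A))"

definition reduction_nonsecret ::
  "('q, 'e) des \<Rightarrow> 'q set \<Rightarrow> 'q set \<Rightarrow> ('c, 'g) nfa \<Rightarrow> 'c \<Rightarrow> ('q, 'c) state set" where
  "reduction_nonsecret G QS QNS A q0 =
     states (opacity_reduction G QS QNS A q0) - reduction_secret G A"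

lemma is_des_opacity_reduction:
  assumes "is_des G" "QS \<subseteq> states G" "QNS \<subseteq> states G" "step_counter K A q0"
  shows "is_des (opacity_reduction G QS QNS A q0)"
proof -
  have fin: "finite (paired_events (observable G) (alphabet A))"
  proof -
    have "paired_events (observable G) (alphabet A) =
        (\<lambda>(a, g). Paired a g) ` (observable G \<times> alphabet A)"
      by (auto simp: paired_events_def)
    moreover have "finite (observable G)" "finite (alphabet A)"
      using assms finite_subset by (auto simp: is_des_def is_nfa_def step_counter_def)
    ultimately show ?thesis by simp
  qed
  have q0: "q0 \<in> states A"
    using assms(4) by (auto simp: step_counter_def is_nfa_def)
  show ?thesis
    using assms fin q0
    by (auto simp: is_des_def is_nfa_def step_counter_def opacity_reduction_def Let_def
        counter_product_def sync_product_def tilde_plus_def tilde_minus_def tilde_counter_def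
        paired_events_def)
qed

end

theory Submission
  imports Defs
begin

text \<open>
  A run of the constructed system that reaches a secret state reads a word \<open>s\<close> of \<open>G\<close>
  leading to a secret state of \<open>G\<close>, then \<open>@\<close>, then a word \<open>t\<close> of \<open>G\<close> whose observable
  letters are paired with the letters of a word \<open>w\<close> of the counter.  The observation of the
  run determines \<open>P s\<close>, \<open>P t\<close> and \<open>w\<close>.  If the counter accepts \<open>w\<close>, then the same run
  also reaches a marked, hence non-secret, state of the product, so that opacity is not at
  stake.  If it does not, then \<open>w\<close> is a prefix of the word \<open>W\<close> of length \<open>K\<close>, hence
  \<open>|P t| \<le> K\<close>, and the only non-secret states that are compatible with the observation lie in
  \<open>G\<^sup>-\<close>: reaching one of them amounts to finding the words \<open>s'\<close> and \<open>t'\<close> of \<open>K\<close>-step opacity.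
\<close>

section \<open>Runs of automata from single states\<close>

text \<open>Reading a word distributes over unions of start sets. This reduces the set-valued
  \<open>delta_star\<close> to runs from one state, the form in which the later run lemmas are
  stated.\<close>

lemma delta_star_iff_singleton:
  "q \<in> delta_star A X w \<longleftrightarrow> (\<exists>p\<in>X. q \<in> delta_star A {p} w)"
proof (induction w arbitrary: X)
  case (Cons a w)
  have "q \<in> delta_star A Y w \<longleftrightarrow> (\<exists>r\<in>Y. q \<in> delta_star A {r} w)" for Y
    using Cons.IH by blast
  from this[of "\<Union>p\<in>X. delta A p a"] this[of "delta A _ a"] show ?case
    by auto
qed simp

lemma delta_star_Cons_iff:
  "q \<in> delta_star A {p} (a # w) \<longleftrightarrow>
     (\<exists>r. (p, a, r) \<in> transitions A \<and> q \<in> delta_star A {r} w)"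
  using delta_star_iff_singleton[of q A "delta A p a" w] by (auto simp: delta_def)

lemma delta_star_append:
  "delta_star A X (u @ v) = delta_star A (delta_star A X u) v"
  by (induction u arbitrary: X) auto

lemma delta_star_empty [simp]: "delta_star A {} w = {}"
  by (induction w) auto

text \<open>Unfolding this equation would replace a singleton start set by a set of successors;
  \<open>delta_star_Cons_iff\<close> keeps runs in singleton form.\<close>

declare delta_star.simps(2) [simp del]

lemma delta_star_append_singleton:
  "q \<in> delta_star A {p} (u @ v) \<longleftrightarrow>
     (\<exists>r. r \<in> delta_star A {p} u \<and> q \<in> delta_star A {r} v)"
  unfolding delta_star_append
  using delta_star_iff_singleton[of q A "delta_star A {p} u" v] by blast

lemma delta_star_word:
  assumes "is_nfa A" "q \<in> delta_star A {p} w"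
  shows "w \<in> lists (alphabet A)"
  using assms(2)
proof (induction w arbitrary: p)
  case (Cons a w)
  then obtain r where "(p, a, r) \<in> transitions A" "q \<in> delta_star A {r} w"
    by (auto simp: delta_star_Cons_iff)
  with Cons.IH assms(1) show ?case by (auto simp: is_nfa_def)
qed simp

lemma delta_star_states:
  assumes "is_nfa A" "q \<in> delta_star A {p} w" "p \<in> states A"
  shows "q \<in> states A"
  using assms(2,3)
proof (induction w arbitrary: p)
  case (Cons a w)
  then obtain r where "(p, a, r) \<in> transitions A" "q \<in> delta_star A {r} w"
    by (auto simp: delta_star_Cons_iff)
  with Cons.IH assms(1) show ?case by (auto simp: is_nfa_def)
qed simp

lemma generated_languageI:
  assumes "is_nfa A" "i \<in> initial A" "q \<in> delta_star A {i} w"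
  shows "w \<in> generated_language A"
  using assms delta_star_word[OF assms(1,3)] delta_star_iff_singleton[of q A "initial A" w]
  by (auto simp: generated_language_def)

text \<open>Membership of the whole word in the generated language is implied by reachability.\<close>

lemma k_step_opaque_iff:
  assumes "is_nfa G"
  shows "k_step_opaque K G QS QNS P \<longleftrightarrow>
    (\<forall>s t i p q. i \<in> initial G \<and> p \<in> delta_star G {i} s \<and> p \<in> QS \<and>
         q \<in> delta_star G {p} t \<and> length (P t) \<le> K \<longrightarrow>
       (\<exists>s' t' i' p' q'. i' \<in> initial G \<and> p' \<in> delta_star G {i'} s' \<and> p' \<in> QNS \<and>
         q' \<in> delta_star G {p'} t' \<and> P s = P s' \<and> P t = P t'))"
proof -
  \<comment> \<open>Premise and conclusion of opacity are the same condition for \<open>QS\<close>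
    and \<open>QNS\<close>, so it is named once, with the state set \<open>X\<close> as a
    parameter.\<close>
  define run where "run X s t \<longleftrightarrow> (\<exists>i p q. i \<in> initial G \<and> p \<in> delta_star G {i} s \<and> p \<in> X \<and>
         q \<in> delta_star G {p} t)" for X s t
  have run: "s @ t \<in> generated_language G \<and> delta_star G (delta_star G (initial G) s \<inter> X) t \<noteq> {}
      \<longleftrightarrow> run X s t" for X s t
  proof -
    have "delta_star G (delta_star G (initial G) s \<inter> X) t \<noteq> {} \<longleftrightarrow> run X s t"
      using delta_star_iff_singleton[of _ G "delta_star G (initial G) s \<inter> X" t]
        delta_star_iff_singleton[of _ G "initial G" s]
      unfolding run_def by blast
    moreover have "s @ t \<in> generated_language G" if "run X s t"
      using that generated_languageI[OF assms] unfolding run_def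
      by (metis delta_star_append_singleton)
    ultimately show ?thesis by blast
  qed
  have "k_step_opaque K G QS QNS P \<longleftrightarrow> (\<forall>s t. length (P t) \<le> K \<and> run QS s t \<longrightarrow>
      (\<exists>s' t'. P s = P s' \<and> P t = P t' \<and> run QNS s' t'))"
    unfolding k_step_opaque_def run[symmetric] by blast
  then show ?thesis unfolding run_def by blast
qed

section \<open>Words over the paired events and their two components\<close>

text \<open>Undoes the pairing: the word of \<open>G\<close> that underlies a run inside one of its
  copies. The value at \<open>At\<close> is a default, since the alphabet of the copies does not
  contain \<open>At\<close>.\<close>

fun base_word :: "('e, 'g) event list \<Rightarrow> 'e list" where
  "base_word [] = []"
| "base_word (Old a # w) = a # base_word w"
| "base_word (Paired a g # w) = a # base_word w"
| "base_word (At # w) = base_word w"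

text \<open>What the counter reads along such a run; \<open>Old\<close> events contribute nothing
  because the copy of \<open>G\<close> executes them alone.\<close>

fun counter_word :: "('e, 'g) event list \<Rightarrow> 'g list" where
  "counter_word [] = []"
| "counter_word (Old a # w) = counter_word w"
| "counter_word (Paired a g # w) = g # counter_word w"
| "counter_word (At # w) = counter_word w"

text \<open>Splitting off the head as a word of its own lets
  \<open>delta_star_append_singleton\<close> apply to \<open>Old\<close> and \<open>Paired\<close>
  events alike.\<close>

lemma base_word_Cons: "base_word (e # w) = base_word [e] @ base_word w"
  by (cases e) auto

lemma counter_word_Cons: "counter_word (e # w) = counter_word [e] @ counter_word w"
  by (cases e) auto

lemma tilde_alphabet_cases:
  assumes "e \<in> alphabet (tilde_minus G Ga)"
  obtains a where "e = Old a" "a \<in> alphabet G" "a \<notin> observable G"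
  | a g where "e = Paired a g" "a \<in> observable G" "g \<in> Ga"
  using assms by (auto simp: tilde_minus_def paired_events_def)

lemma counter_word_lists:
  "w \<in> lists (alphabet (tilde_minus G Ga)) \<Longrightarrow> counter_word w \<in> lists Ga"
proof (induction w)
  case (Cons e w)
  then have "e \<in> alphabet (tilde_minus G Ga)" and "counter_word w \<in> lists Ga" by auto
  then show ?case by (cases rule: tilde_alphabet_cases) auto
qed simp

text \<open>The letters of \<open>g\<close> are handed out in order to the observable letters of
  \<open>u\<close>, while unobservable letters stay \<open>Old\<close>; hence the condition on the
  lengths. This lifts runs of \<open>G\<close> to runs of the copies with a prescribed counter
  word.\<close>

lemma ex_paired_word:
  assumes "u \<in> lists (alphabet G)" "g \<in> lists Ga"
    "length g = length (projection (observable G) u)"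
  shows "\<exists>v \<in> lists (alphabet (tilde_minus G Ga)). base_word v = u \<and> counter_word v = g"
  using assms
proof (induction u arbitrary: g rule: lists.induct)
  case Nil
  then show ?case by (auto simp: projection_def intro!: bexI[of _ "[]"])
next
  case (Cons a u)
  show ?case
  proof (cases "a \<in> observable G")
    case True
    with Cons.prems obtain c g' where g: "g = c # g'"
      by (auto simp: projection_def length_Suc_conv)
    with Cons.prems True have "length g' = length (projection (observable G) u)" "g' \<in> lists Ga"
      by (auto simp: projection_def)
    with Cons.IH[of g'] Cons.prems(1) obtain v where v:
      "v \<in> lists (alphabet (tilde_minus G Ga))" "base_word v = u" "counter_word v = g'"
      by auto
    have "Paired a c \<in> alphabet (tilde_minus G Ga)"
      using True g Cons.prems by (auto simp: tilde_minus_def paired_events_def)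
    with v g show ?thesis by (intro bexI[of _ "Paired a c # v"]) auto
  next
    case False
    then have "length g = length (projection (observable G) u)"
      using Cons.prems by (simp add: projection_def)
    with Cons.IH[of g] Cons.prems obtain v where v:
      "v \<in> lists (alphabet (tilde_minus G Ga))" "base_word v = u" "counter_word v = g"
      by auto
    have "Old a \<in> alphabet (tilde_minus G Ga)"
      using False Cons.hyps(1) by (auto simp: tilde_minus_def)
    with v show ?thesis by (intro bexI[of _ "Old a # v"]) auto
  qed
qed

text \<open>No letter of \<open>map Old u\<close> is \<open>At\<close>, so the first
  \<open>At\<close> fixes where the word splits.\<close>

lemma map_Old_At_eq_iff:
  "map Old u @ At # v = map Old u' @ At # v' \<longleftrightarrow> u = u' \<and> v = v'"
proof (induction u arbitrary: u')
  case Nil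
  show ?case by (cases u') auto
next
  case (Cons a u)
  then show ?case by (cases u') auto
qed

lemma is_nfa_if_is_des: "is_des G \<Longrightarrow> is_nfa G"
  by (simp add: is_des_def)

section \<open>Transitions and runs of the constructed system\<close>

context
  fixes G :: "('q, 'e) des" and QS QNS :: "'q set" and A :: "('c, 'g) nfa" and q0 :: 'c
    and R :: "(('q, 'c) state, ('e, 'g) event) des"
  defines "R \<equiv> opacity_reduction G QS QNS A q0"
begin

lemma transitions_Minus:
  "(Minus p, e, y) \<in> transitions R \<longleftrightarrow>
     (\<exists>q. y = Minus q \<and> (p, e, q) \<in> transitions (tilde_minus G (alphabet A)))"
  by (auto simp: R_def opacity_reduction_def Let_def)

lemma transitions_Plus:
  "(Plus x, e, y) \<in> transitions R \<longleftrightarrow>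
     (\<exists>z. y = Plus z \<and> (x, e, z) \<in> transitions (counter_product G A))"
  by (cases x) (auto simp: R_def opacity_reduction_def Let_def)

lemma transitions_Orig:
  "(Orig p, e, y) \<in> transitions R \<longleftrightarrow>
     (\<exists>a q. e = Old a \<and> y = Orig q \<and> (p, a, q) \<in> transitions G) \<or>
     (e = At \<and> p \<in> QS \<and> y = Plus (p, q0)) \<or> (e = At \<and> p \<in> QNS \<and> y = Minus p)"
  by (auto simp: R_def opacity_reduction_def Let_def)

text \<open>With a step expressed as a run over \<open>base_word [e]\<close>, runs of the copy arise
  by concatenation.\<close>

lemma transitions_tilde_minus:
  assumes "is_des G"
  shows "(p, e, q) \<in> transitions (tilde_minus G (alphabet A)) \<longleftrightarrow>
    e \<in> alphabet (tilde_minus G (alphabet A)) \<and> q \<in> delta_star G {p} (base_word [e])"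
  using assms
  by (cases e) (auto simp: tilde_minus_def paired_events_def is_des_def is_nfa_def delta_star_Cons_iff)

text \<open>On an unobservable event \<open>counter_word [e]\<close> is empty, which forces
  \<open>d = c\<close>: the counter idles. The product allows this only in counter states, whence
  the hypothesis on \<open>c\<close>.\<close>

lemma transitions_counter_product:
  assumes "is_des G" "is_nfa A" "c \<in> states A"
  shows "((p, c), e, (q, d)) \<in> transitions (counter_product G A) \<longleftrightarrow>
    e \<in> alphabet (tilde_minus G (alphabet A)) \<and> q \<in> delta_star G {p} (base_word [e]) \<and>
    d \<in> delta_star A {c} (counter_word [e])"
  using assms
  by (cases e) (auto simp: counter_product_def sync_product_def tilde_plus_def tilde_minus_def
      tilde_counter_def paired_events_def is_des_def is_nfa_def delta_star_Cons_iff)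

lemma delta_star_Minus:
  assumes "is_des G"
  shows "y \<in> delta_star R {Minus p} w \<longleftrightarrow>
    (\<exists>q. y = Minus q \<and> w \<in> lists (alphabet (tilde_minus G (alphabet A))) \<and>
       q \<in> delta_star G {p} (base_word w))"
proof (induction w arbitrary: p)
  case (Cons e w)
  have "y \<in> delta_star R {Minus p} (e # w) \<longleftrightarrow>
    (\<exists>r. (p, e, r) \<in> transitions (tilde_minus G (alphabet A)) \<and> y \<in> delta_star R {Minus r} w)"
    unfolding delta_star_Cons_iff transitions_Minus by auto
  then show ?case
    unfolding transitions_tilde_minus[OF assms] Cons.IH Cons_in_lists_iff
      base_word_Cons[of e w] delta_star_append_singleton by blast
qed auto

text \<open>The components synchronize exactly on the paired events, so a run of the product is a
  pair of independent runs over the two component words.\<close>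

lemma delta_star_Plus:
  assumes "is_des G" "is_nfa A" "c \<in> states A"
  shows "y \<in> delta_star R {Plus (p, c)} w \<longleftrightarrow>
    (\<exists>q d. y = Plus (q, d) \<and> w \<in> lists (alphabet (tilde_minus G (alphabet A))) \<and>
       q \<in> delta_star G {p} (base_word w) \<and> d \<in> delta_star A {c} (counter_word w))"
  using assms(3)
proof (induction w arbitrary: p c)
  case (Cons e w)
  have "y \<in> delta_star R {Plus (p, c)} (e # w) \<longleftrightarrow>
    (\<exists>r b. ((p, c), e, (r, b)) \<in> transitions (counter_product G A) \<and>
      y \<in> delta_star R {Plus (r, b)} w)"
    unfolding delta_star_Cons_iff transitions_Plus by auto
  \<comment> \<open>The induction hypothesis asks for \<open>b\<close> to be a counter state;
    \<open>delta_star_states\<close> provides this, and \<open>conj_cong\<close> makes it available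
    under the conjunction.\<close>
  also have "\<dots> \<longleftrightarrow>
    (\<exists>r b. e \<in> alphabet (tilde_minus G (alphabet A)) \<and> r \<in> delta_star G {p} (base_word [e]) \<and>
      b \<in> delta_star A {c} (counter_word [e]) \<and>
      (\<exists>q d. y = Plus (q, d) \<and> w \<in> lists (alphabet (tilde_minus G (alphabet A))) \<and>
       q \<in> delta_star G {r} (base_word w) \<and> d \<in> delta_star A {b} (counter_word w)))"
    unfolding transitions_counter_product[OF assms(1,2) Cons.prems]
    using Cons.IH delta_star_states[OF assms(2) _ Cons.prems] by (simp cong: conj_cong)
  also have "\<dots> \<longleftrightarrow>
    (\<exists>q d. y = Plus (q, d) \<and> e # w \<in> lists (alphabet (tilde_minus G (alphabet A))) \<and>
       q \<in> delta_star G {p} (base_word (e # w)) \<and> d \<in> delta_star A {c} (counter_word (e # w)))"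
    unfolding base_word_Cons[of e w] counter_word_Cons[of e w] delta_star_append_singleton
    by auto
  finally show ?case .
qed auto

text \<open>From an \<open>Orig\<close> state, \<open>Old\<close> events stay in \<open>G\<close>
  and \<open>At\<close> moves into one of the copies, so a run either stays in \<open>G\<close> or
  splits at its first \<open>At\<close>.\<close>

lemma delta_star_Orig:
  "y \<in> delta_star R {Orig p} w \<longleftrightarrow>
    (\<exists>u q. w = map Old u \<and> y = Orig q \<and> q \<in> delta_star G {p} u) \<or>
    (\<exists>u v q. w = map Old u @ At # v \<and> q \<in> delta_star G {p} u \<and>
       (q \<in> QS \<and> y \<in> delta_star R {Plus (q, q0)} v \<or> q \<in> QNS \<and> y \<in> delta_star R {Minus q} v))"
    (is "_ \<longleftrightarrow> ?in_orig p w \<or> ?left_orig p w")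
proof (induction w arbitrary: p)
  case (Cons e w)
  show ?case
  proof (cases e)
    case (Old a)
    \<comment> \<open>The leading \<open>Old a\<close> forces \<open>u\<close> to be nonempty, so
      each alternative passes to the successors of \<open>p\<close> under \<open>a\<close>.\<close>
    have "?in_orig p (e # w) \<longleftrightarrow> (\<exists>r. (p, a, r) \<in> transitions G \<and> ?in_orig r w)"
    proof -
      have eq: "e # w = map Old u \<longleftrightarrow> (\<exists>u'. u = a # u' \<and> w = map Old u')" for u
        using Old by (cases u) auto
      have "?in_orig p (e # w) \<longleftrightarrow>
        (\<exists>u q. w = map Old u \<and> y = Orig q \<and> q \<in> delta_star G {p} (a # u))"
        unfolding eq by blast
      also have "\<dots> \<longleftrightarrow> (\<exists>r. (p, a, r) \<in> transitions G \<and> ?in_orig r w)"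
        unfolding delta_star_Cons_iff by blast
      finally show ?thesis .
    qed
    moreover have "?left_orig p (e # w) \<longleftrightarrow> (\<exists>r. (p, a, r) \<in> transitions G \<and> ?left_orig r w)"
    proof -
      have eq: "e # w = map Old u @ At # v \<longleftrightarrow> (\<exists>u'. u = a # u' \<and> w = map Old u' @ At # v)" for u v
        using Old by (cases u) auto
      have "?left_orig p (e # w) \<longleftrightarrow>
        (\<exists>u v q. w = map Old u @ At # v \<and> q \<in> delta_star G {p} (a # u) \<and>
          (q \<in> QS \<and> y \<in> delta_star R {Plus (q, q0)} v \<or>
           q \<in> QNS \<and> y \<in> delta_star R {Minus q} v))"
        unfolding eq by blast
      also have "\<dots> \<longleftrightarrow> (\<exists>r. (p, a, r) \<in> transitions G \<and> ?left_orig r w)"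
        unfolding delta_star_Cons_iff by blast
      finally show ?thesis .
    qed
    moreover have "y \<in> delta_star R {Orig p} (e # w) \<longleftrightarrow>
      (\<exists>r. (p, a, r) \<in> transitions G \<and> y \<in> delta_star R {Orig r} w)"
      using Old unfolding delta_star_Cons_iff transitions_Orig by auto
    ultimately show ?thesis
      unfolding Cons.IH by (simp only: ex_disj_distrib conj_disj_distribL)
  next
    \<comment> \<open>No paired event leaves an \<open>Orig\<close> state, and no word of either
      shape starts with one, so both sides are false.\<close>
    case (Paired a g)
    then have "e # w \<noteq> map Old u" "e # w \<noteq> map Old u @ At # v" for u v
      by (cases u; simp)+
    then show ?thesis
      using Paired unfolding delta_star_Cons_iff transitions_Orig by simp
  next
    case At
    then have "e # w \<noteq> map Old u" "e # w = map Old u @ At # v \<longleftrightarrow> u = [] \<and> v = w" for u v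
      by (cases u; auto)+
    then show ?thesis
      using At unfolding delta_star_Cons_iff transitions_Orig by auto
  qed
qed auto

section \<open>Observations of runs\<close>

lemma observable_reduction:
  "Old a \<in> observable R \<longleftrightarrow> a \<in> observable G"
  "At \<in> observable R"
  "Paired a g \<in> observable R \<longleftrightarrow> a \<in> observable G \<and> g \<in> alphabet A"
  by (auto simp: R_def opacity_reduction_def Let_def paired_events_def)

lemma initial_reduction: "initial R = Orig ` initial G"
  by (simp add: R_def opacity_reduction_def Let_def)

lemma projection_map_Old:
  "projection (observable R) (map Old u) = map Old (projection (observable G) u)"
  by (induction u) (auto simp: projection_def observable_reduction)

lemma projection_run:
  "projection (observable R) (map Old u @ At # v) =
     map Old (projection (observable G) u) @ At # projection (observable R) v"
  using projection_map_Old[of u] by (simp add: projection_def observable_reduction)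

text \<open>Inside a copy the \<open>Old\<close> events are unobservable and every observable letter
  of \<open>G\<close> occurs paired with one counter letter; the observation is therefore the two
  component words zipped together.\<close>

lemma projection_paired:
  assumes "v \<in> lists (alphabet (tilde_minus G (alphabet A)))"
  shows "length (projection (observable G) (base_word v)) = length (counter_word v)"
    and "projection (observable R) v =
       map2 Paired (projection (observable G) (base_word v)) (counter_word v)"
proof -
  have "length (projection (observable G) (base_word v)) = length (counter_word v) \<and>
    projection (observable R) v =
       map2 Paired (projection (observable G) (base_word v)) (counter_word v)"
    using assms
  proof (induction v)
    case (Cons e v)
    then have IH: "length (projection (observable G) (base_word v)) = length (counter_word v)"
      "projection (observable R) v =
         map2 Paired (projection (observable G) (base_word v)) (counter_word v)"
      and e: "e \<in> alphabet (tilde_minus G (alphabet A))" by auto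
    from e show ?case
      by (cases rule: tilde_alphabet_cases)
        (use IH in \<open>auto simp: projection_def observable_reduction\<close>)
  qed (simp add: projection_def)
  then show "length (projection (observable G) (base_word v)) = length (counter_word v)"
    "projection (observable R) v =
       map2 Paired (projection (observable G) (base_word v)) (counter_word v)"
    by auto
qed

lemma projection_paired_eq_iff:
  assumes "v \<in> lists (alphabet (tilde_minus G (alphabet A)))"
    "v' \<in> lists (alphabet (tilde_minus G (alphabet A)))"
  shows "projection (observable R) v = projection (observable R) v' \<longleftrightarrow>
    projection (observable G) (base_word v) = projection (observable G) (base_word v') \<and>
    counter_word v = counter_word v'"
proof -
  \<comment> \<open>\<open>map2\<close> truncates to the shorter list; the equal lengths make the
    zip reversible.\<close>
  have "map2 Paired xs ys = map2 Paired xs' ys' \<longleftrightarrow> xs = xs' \<and> ys = ys'"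
    if "length xs = length ys" "length xs' = length ys'" for xs xs' :: "'e list" and ys ys' :: "'g list"
    using that
  proof (induction xs ys arbitrary: xs' ys' rule: list_induct2)
    case Nil
    then show ?case by (cases xs'; cases ys') auto
  next
    case (Cons x xs y ys)
    then show ?case by (cases xs'; cases ys') auto
  qed
  then show ?thesis using projection_paired[OF assms(1)] projection_paired[OF assms(2)] by simp
qed

section \<open>Current-state opacity and the secret states of the construction\<close>

text \<open>For the bound 0 the second word has an empty observation, so on either side it can be
  taken to be empty.\<close>

lemma current_state_opaque_iff:
  assumes "is_nfa R"
  shows "current_state_opaque R X Y (projection (observable R)) \<longleftrightarrow>
    (\<forall>s i x. i \<in> initial G \<and> x \<in> delta_star R {Orig i} s \<and> x \<in> X \<longrightarrow>
      (\<exists>s' i' y. i' \<in> initial G \<and> y \<in> delta_star R {Orig i'} s' \<and> y \<in> Y \<and>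
        projection (observable R) s = projection (observable R) s'))"
    (is "_ \<longleftrightarrow> ?rhs")
proof
  assume l: "current_state_opaque R X Y (projection (observable R))"
  show ?rhs
  proof (intro allI impI, elim conjE)
    fix s i x
    assume a: "i \<in> initial G" "x \<in> delta_star R {Orig i} s" "x \<in> X"
    then have "Orig i \<in> initial R" "x \<in> delta_star R {x} []"
      "length (projection (observable R) []) \<le> 0"
      by (auto simp: initial_reduction projection_def)
    \<comment> \<open>The empty second word meets the bound; of the answer only the first word is
      kept.\<close>
    with a(2,3) obtain s' t' j y z where "j \<in> initial R" "y \<in> delta_star R {j} s'" "y \<in> Y"
      "projection (observable R) s = projection (observable R) s'"
      using l[unfolded current_state_opaque_def k_step_opaque_iff[OF assms], rule_format,
          of "Orig i" x s x "[]"] by blast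
    then show "\<exists>s' i' y. i' \<in> initial G \<and> y \<in> delta_star R {Orig i'} s' \<and> y \<in> Y \<and>
        projection (observable R) s = projection (observable R) s'"
      unfolding initial_reduction by blast
  qed
next
  assume r: ?rhs
  show "current_state_opaque R X Y (projection (observable R))"
    unfolding current_state_opaque_def k_step_opaque_iff[OF assms]
  proof (intro allI impI, elim conjE)
    fix s t i p q
    assume a: "i \<in> initial R" "p \<in> delta_star R {i} s" "p \<in> X"
      "length (projection (observable R) t) \<le> 0"
    then obtain s' i' y where "i' \<in> initial G" "y \<in> delta_star R {Orig i'} s'" "y \<in> Y"
      "projection (observable R) s = projection (observable R) s'"
      using r unfolding initial_reduction by blast
    moreover have "y \<in> delta_star R {y} []"
      "projection (observable R) t = projection (observable R) []"
      using a by (auto simp: projection_def)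
    ultimately show "\<exists>s' t' i' p' q'. i' \<in> initial R \<and> p' \<in> delta_star R {i'} s' \<and> p' \<in> Y \<and>
         q' \<in> delta_star R {p'} t' \<and>
         projection (observable R) s = projection (observable R) s' \<and>
         projection (observable R) t = projection (observable R) t'"
      unfolding initial_reduction by blast
  qed
qed

text \<open>All states of \<open>tilde_plus\<close> are marked, so the counter component alone
  decides secrecy.\<close>

lemma Plus_in_reduction_secret:
  "Plus (p, c) \<in> reduction_secret G A \<longleftrightarrow> p \<in> states G \<and> c \<in> states A \<and> c \<notin> marked A"
  by (auto simp: reduction_secret_def counter_product_def sync_product_def tilde_plus_def
      tilde_minus_def tilde_counter_def)

lemma reduction_secret_cases:
  assumes "x \<in> reduction_secret G A"
  obtains p c where "x = Plus (p, c)"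
  using assms by (auto simp: reduction_secret_def)

lemma states_reduction:
  "Minus p \<in> states R \<longleftrightarrow> p \<in> states G"
  "Plus (p, c) \<in> states R \<longleftrightarrow> p \<in> states G \<and> c \<in> states A"
  by (auto simp: R_def opacity_reduction_def Let_def counter_product_def sync_product_def
      tilde_plus_def tilde_minus_def tilde_counter_def)

lemma Minus_in_reduction_nonsecret:
  "Minus p \<in> reduction_nonsecret G QS QNS A q0 \<longleftrightarrow> p \<in> states G"
  using states_reduction(1)[of p]
  by (auto simp: reduction_nonsecret_def R_def elim: reduction_secret_cases)

lemma Plus_in_reduction_nonsecret:
  "Plus (p, c) \<in> reduction_nonsecret G QS QNS A q0 \<longleftrightarrow>
     p \<in> states G \<and> c \<in> states A \<and> c \<in> marked A"
  using states_reduction(2)[of p c]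
  by (auto simp: reduction_nonsecret_def R_def Plus_in_reduction_secret)

end

section \<open>The rejected words of the counter\<close>

text \<open>A word can be rejected because it is blocked or because it reaches only unmarked states.
  The last fact excludes blocking for prefixes of \<open>W\<close>, so that they lead to actual
  secret states of the product.\<close>

lemma step_counter_word:
  assumes "step_counter K A q0"
  obtains W where "W \<in> lists (alphabet A)" "length W = K"
    "\<And>w. w \<in> lists (alphabet A) \<Longrightarrow> delta_star A {q0} w \<inter> marked A = {} \<longleftrightarrow> prefix w W"
    "\<And>w. prefix w W \<Longrightarrow> delta_star A {q0} w \<noteq> {}"
proof -
  from assms obtain W where nfa: "is_nfa A" and init: "initial A = {q0}"
    and W: "W \<in> lists (alphabet A)" "length W = K"
      "lists (alphabet A) - marked_language A = {w. prefix w W}"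
    unfolding step_counter_def by blast
  have unmarked: "delta_star A {q0} w \<inter> marked A = {} \<longleftrightarrow> prefix w W"
    if "w \<in> lists (alphabet A)" for w
    using W(3) that unfolding marked_language_def init by blast
  from nfa obtain g where g: "g \<in> alphabet A" by (auto simp: is_nfa_def)
  \<comment> \<open>One letter beyond \<open>W\<close> the counter accepts, hence it has a run over
    \<open>W @ [g]\<close> and over each prefix of \<open>W\<close>.\<close>
  have "\<not> prefix (W @ [g]) W" using prefix_length_le by fastforce
  then have ne: "delta_star A {q0} (W @ [g]) \<noteq> {}" using unmarked[of "W @ [g]"] W(1) g by auto
  have "delta_star A {q0} w \<noteq> {}" if "prefix w W" for w
  proof -
    from that obtain v where "W = w @ v" by (auto simp: prefix_def)
    with ne show ?thesis by (auto simp: delta_star_append)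
  qed
  with W(1,2) unmarked that show ?thesis by blast
qed

section \<open>Equivalence of the two opacity properties\<close>

theorem theorem10:
  fixes K :: nat
    and G :: "('q, 'e) des"
    and QS QNS :: "'q set"
    and A :: "('c, 'g) nfa"
    and q0 :: 'c
  assumes "is_des G"
    and "QS \<subseteq> states G"
    and "QNS \<subseteq> states G"
    and "step_counter K A q0"
  shows "k_step_opaque K G QS QNS (projection (observable G)) \<longleftrightarrow>
    current_state_opaque (opacity_reduction G QS QNS A q0)
      (reduction_secret G A) (reduction_nonsecret G QS QNS A q0)
      (projection (observable (opacity_reduction G QS QNS A q0)))"
proof -
  let ?R = "opacity_reduction G QS QNS A q0"
  let ?P = "projection (observable G)" and ?P' = "projection (observable ?R)"
  let ?S = "reduction_secret G A" and ?N = "reduction_nonsecret G QS QNS A q0"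
  let ?L = "lists (alphabet (tilde_minus G (alphabet A)))"
  have nfaG: "is_nfa G" using assms(1) by (rule is_nfa_if_is_des)
  have nfaR: "is_nfa ?R" using is_des_opacity_reduction[OF assms] by (rule is_nfa_if_is_des)
  have nfaA: "is_nfa A" and q0: "q0 \<in> states A"
    using assms(4) by (auto simp: step_counter_def is_nfa_def)
  obtain W where W: "W \<in> lists (alphabet A)" "length W = K"
    and unmarked: "\<And>w. w \<in> lists (alphabet A) \<Longrightarrow>
      delta_star A {q0} w \<inter> marked A = {} \<longleftrightarrow> prefix w W"
    and unblocked: "\<And>w. prefix w W \<Longrightarrow> delta_star A {q0} w \<noteq> {}"
    using step_counter_word[OF assms(4)] by metis
  note Plus = delta_star_Plus[OF assms(1) nfaA q0] and Minus = delta_star_Minus[OF assms(1)]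
  have run_Plus: "Plus (q, d) \<in> delta_star ?R {Orig i} (map Old u @ At # v)"
    if "p \<in> delta_star G {i} u" "p \<in> QS" "v \<in> ?L" "q \<in> delta_star G {p} (base_word v)"
      "d \<in> delta_star A {q0} (counter_word v)" for i p q d u v
  proof -
    have "Plus (q, d) \<in> delta_star ?R {Plus (p, q0)} v"
      unfolding Plus using that(3-5) by blast
    with that(1,2) show ?thesis unfolding delta_star_Orig by blast
  qed
  have run_Minus: "Minus q \<in> delta_star ?R {Orig i} (map Old u @ At # v)"
    if "p \<in> delta_star G {i} u" "p \<in> QNS" "v \<in> ?L" "q \<in> delta_star G {p} (base_word v)"
    for i p q u v
  proof -
    have "Minus q \<in> delta_star ?R {Minus p} v"
      unfolding Minus using that(3,4) by blast
    with that(1,2) show ?thesis unfolding delta_star_Orig by blast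
  qed
  show ?thesis
    unfolding k_step_opaque_iff[OF nfaG] current_state_opaque_iff[OF nfaR]
  proof (intro iffI allI impI; elim conjE)

    \<comment> \<open>From \<open>K\<close>-step opacity of \<open>G\<close> to current-state
      opacity\<close>
    fix s i x
    assume opaque: "\<forall>s t i p q. i \<in> initial G \<and> p \<in> delta_star G {i} s \<and> p \<in> QS \<and>
         q \<in> delta_star G {p} t \<and> length (?P t) \<le> K \<longrightarrow>
       (\<exists>s' t' i' p' q'. i' \<in> initial G \<and> p' \<in> delta_star G {i'} s' \<and> p' \<in> QNS \<and>
         q' \<in> delta_star G {p'} t' \<and> ?P s = ?P s' \<and> ?P t = ?P t')"
      and i: "i \<in> initial G" and x: "x \<in> delta_star ?R {Orig i} s" "x \<in> ?S"
    obtain q c where xq: "x = Plus (q, c)" using x(2) by (rule reduction_secret_cases)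
    \<comment> \<open>A run that ends in a \<open>Plus\<close> state has read \<open>At\<close>, and
      it did so in a secret state of \<open>G\<close>.\<close>
    from x(1) xq obtain u v p where s: "s = map Old u @ At # v" and p: "p \<in> delta_star G {i} u"
      "p \<in> QS" and v: "v \<in> ?L" and q: "q \<in> delta_star G {p} (base_word v)"
      unfolding delta_star_Orig by (auto simp: Plus Minus)
    let ?w = "counter_word v"
    have w: "?w \<in> lists (alphabet A)" using v by (rule counter_word_lists)
    show "\<exists>s' i' y. i' \<in> initial G \<and> y \<in> delta_star ?R {Orig i'} s' \<and> y \<in> ?N \<and> ?P' s = ?P' s'"
    proof (cases "delta_star A {q0} ?w \<inter> marked A = {}")
      case False
      \<comment> \<open>The witness is \<open>s\<close> itself: only the counter component of the
        state reached changes, from \<open>c\<close> to \<open>d\<close>.\<close>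
      then obtain d where d: "d \<in> delta_star A {q0} ?w" "d \<in> marked A" by blast
      then have "Plus (q, d) \<in> delta_star ?R {Orig i} s"
        unfolding s using run_Plus[OF p v q] by blast
      moreover have "Plus (q, d) \<in> ?N"
        using d x(2) nfaA unfolding xq Plus_in_reduction_nonsecret Plus_in_reduction_secret
        by (auto simp: is_nfa_def)
      ultimately show ?thesis using i by blast
    next
      case True
      then have "length ?w \<le> K" using unmarked[OF w] prefix_length_le W(2) by blast
      then have "length (?P (base_word v)) \<le> K"
        using projection_paired(1)[OF v] by simp
      with opaque i p q obtain u' t' i' p' q' where i': "i' \<in> initial G"
        and p': "p' \<in> delta_star G {i'} u'" "p' \<in> QNS" and q': "q' \<in> delta_star G {p'} t'"
        and P: "?P u = ?P u'" "?P (base_word v) = ?P t'" by metis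
      \<comment> \<open>The observations of \<open>base_word v\<close> and \<open>t'\<close> agree,
        so the same counter letters can be distributed over \<open>t'\<close>; this makes the lifted
        words observationally equal.\<close>
      have "length ?w = length (?P t')" using projection_paired(1)[OF v] P by simp
      then obtain v' where v': "v' \<in> ?L" "base_word v' = t'" "counter_word v' = ?w"
        using ex_paired_word[OF delta_star_word[OF nfaG q'] w] by blast
      let ?s' = "map Old u' @ At # v'"
      have "Minus q' \<in> delta_star ?R {Orig i'} ?s'"
        using run_Minus[OF p' v'(1)] q' v'(2) by blast
      moreover have "?P' s = ?P' ?s'"
        using P projection_paired_eq_iff[OF v v'(1)] v' by (simp add: s projection_run)
      moreover have "Minus q' \<in> ?N"
        using delta_star_states[OF nfaG q'] p'(2) assms(3)
        unfolding Minus_in_reduction_nonsecret by blast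
      ultimately show ?thesis using i' by blast
    qed
  next

    \<comment> \<open>From current-state opacity to \<open>K\<close>-step opacity of
      \<open>G\<close>\<close>
    fix s t i p q
    assume opaque: "\<forall>s i x. i \<in> initial G \<and> x \<in> delta_star ?R {Orig i} s \<and> x \<in> ?S \<longrightarrow>
      (\<exists>s' i' y. i' \<in> initial G \<and> y \<in> delta_star ?R {Orig i'} s' \<and> y \<in> ?N \<and> ?P' s = ?P' s')"
      and i: "i \<in> initial G" and p: "p \<in> delta_star G {i} s" "p \<in> QS"
      and q: "q \<in> delta_star G {p} t" and t: "length (?P t) \<le> K"
    \<comment> \<open>As \<open>W\<close> has length \<open>K\<close>, the bound on
      \<open>?P t\<close> ensures that \<open>take\<close> yields exactly one counter letter per
      observable letter of \<open>t\<close>; any prefix of \<open>W\<close> leads only to unmarked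
      counter states.\<close>
    define w where "w = take (length (?P t)) W"
    have w: "prefix w W" "w \<in> lists (alphabet A)" "length w = length (?P t)"
      using W t by (auto simp: w_def take_is_prefix dest: in_set_takeD)
    obtain v where v: "v \<in> ?L" "base_word v = t" "counter_word v = w"
      using ex_paired_word[OF delta_star_word[OF nfaG q] w(2,3)] by blast
    obtain c where c: "c \<in> delta_star A {q0} w" using unblocked[OF w(1)] by blast
    let ?s = "map Old s @ At # v"
    have "Plus (q, c) \<in> delta_star ?R {Orig i} ?s"
      using run_Plus[OF p v(1)] q c v(2,3) by blast
    moreover have "Plus (q, c) \<in> ?S"
      using c unmarked[OF w(2)] w(1) delta_star_states[OF nfaG q] p(2) assms(2)
        delta_star_states[OF nfaA c q0]
      unfolding Plus_in_reduction_secret by blast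
    ultimately obtain s' i' y where i': "i' \<in> initial G" and y: "y \<in> delta_star ?R {Orig i'} s'"
      "y \<in> ?N" and P': "?P' ?s = ?P' s'" using opaque i by blast
    \<comment> \<open>The observable \<open>At\<close> shows that \<open>s'\<close> has left
      \<open>G\<close>, which excludes the first alternative of
      \<open>delta_star_Orig\<close>.\<close>
    have "At \<in> set (?P' ?s)" by (simp add: projection_run)
    moreover have "At \<notin> set (?P' (map Old u))" for u by (auto simp: projection_def)
    ultimately have "s' \<noteq> map Old u" for u using P' by metis
    then obtain u v' p' where s': "s' = map Old u @ At # v'" and p': "p' \<in> delta_star G {i'} u"
      and y': "p' \<in> QS \<and> y \<in> delta_star ?R {Plus (p', q0)} v' \<or>
        p' \<in> QNS \<and> y \<in> delta_star ?R {Minus p'} v'"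
      using y(1) unfolding delta_star_Orig by blast
    have v': "v' \<in> ?L" using y' unfolding Plus Minus by blast
    have P: "?P s = ?P u" "?P' v = ?P' v'"
      using P' unfolding s' projection_run map_Old_At_eq_iff by auto
    have v_eq: "?P t = ?P (base_word v')" "counter_word v' = w"
      using P(2) projection_paired_eq_iff[OF v(1) v'] v by auto
    from y' obtain q' where "p' \<in> QNS" "q' \<in> delta_star G {p'} (base_word v')"
    proof
      \<comment> \<open>The run of \<open>v'\<close> carries the same counter word \<open>w\<close>,
        which reaches no marked counter state; a product state reached here would be secret,
        contrary to the choice of \<open>y\<close>.\<close>
      assume "p' \<in> QS \<and> y \<in> delta_star ?R {Plus (p', q0)} v'"
      then obtain r d where "y = Plus (r, d)" "d \<in> delta_star A {q0} w"
        unfolding Plus v_eq(2) by blast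
      with y(2) unmarked[OF w(2)] w(1) have False
        by (auto simp: Plus_in_reduction_nonsecret)
      then show thesis ..
    next
      assume "p' \<in> QNS \<and> y \<in> delta_star ?R {Minus p'} v'"
      then show thesis using that unfolding Minus by blast
    qed
    with i' p' P(1) v_eq(1) show "\<exists>s' t' i' p' q'. i' \<in> initial G \<and> p' \<in> delta_star G {i'} s' \<and>
        p' \<in> QNS \<and> q' \<in> delta_star G {p'} t' \<and> ?P s = ?P s' \<and> ?P t = ?P t'"
      by blast
  qed
qed

end
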